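(* Let $\mathcal{H}$ be a complex separable Hilbert space and let $\Phi:\mathcal{B}_1(\mathcal{H})\to\mathcal{B}_1(\mathcal{H})$ be a linear map which is Hermiticity preserving and trace preserving. Then $\Phi$ is positive if and only if $\Phi$ is contractive on Hermitian operators, i.e. $\|\Phi(X)\|_1\le \|X\|_1$ for all Hermitian operators $X\in\mathcal{B}_1(\mathcal{H})$.
   Context: $\mathcal{B}_1(\mathcal{H})$ is the space of trace class operators on $\mathcal{H}$ and $\|X\|_1=\mathrm{Tr}|X|$ is the trace norm. A linear map $\Phi$ on $\mathcal{B}_1(\mathcal{H})$ is Hermiticity preserving if it maps Hermitian (self-adjoint) operators to Hermitian operators, trace preserving if $\mathrm{Tr}\,\Phi(X)=\mathrm{Tr}\,X$ for all $X$, and positive if $\Phi(X)\ge 0$ whenever $X\ge 0$. *)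

theory Defs
  imports "HOL-Analysis.Analysis"
begin

(* A complex inner product space is presented as a real one, with inner product
   the real part of the complex one; norm, metric and topology come from real_inner.
   cinner is conjugate-linear in the first and linear in the second argument. *)

class complex_vector = real_vector +
  fixes scaleC :: "complex \<Rightarrow> 'a \<Rightarrow> 'a" (infixr \<open>*\<^sub>C\<close> 75)
  assumes scaleC_add_right: "a *\<^sub>C (x + y) = a *\<^sub>C x + a *\<^sub>C y"
    and scaleC_add_left: "(a + b) *\<^sub>C x = a *\<^sub>C x + b *\<^sub>C x"
    and scaleC_scaleC: "a *\<^sub>C (b *\<^sub>C x) = (a * b) *\<^sub>C x"
    and scaleC_of_real: "complex_of_real r *\<^sub>C x = r *\<^sub>R x"

class complex_inner = complex_vector + real_inner +
  fixes cinner :: "'a \<Rightarrow> 'a \<Rightarrow> complex"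
  assumes cinner_commute: "cinner x y = cnj (cinner y x)"
    and cinner_add_right: "cinner x (y + z) = cinner x y + cinner x z"
    and cinner_scaleC_right: "cinner x (a *\<^sub>C y) = a * cinner x y"
    and Re_cinner: "Re (cinner x y) = inner x y"

class chilbert_space = complex_inner + complete_space

definition bounded_clinear :: "('h::complex_inner \<Rightarrow> 'h) \<Rightarrow> bool" where
  "bounded_clinear T \<longleftrightarrow> bounded_linear T \<and> (\<forall>c x. T (c *\<^sub>C x) = c *\<^sub>C T x)"

definition is_adjoint :: "('h::complex_inner \<Rightarrow> 'h) \<Rightarrow> ('h \<Rightarrow> 'h) \<Rightarrow> bool" where
  "is_adjoint S T \<longleftrightarrow> (\<forall>x y. cinner (S x) y = cinner x (T y))"

definition cadjoint :: "('h::complex_inner \<Rightarrow> 'h) \<Rightarrow> ('h \<Rightarrow> 'h)" where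
  "cadjoint T = (THE S. is_adjoint S T)"

definition hermitian :: "('h::complex_inner \<Rightarrow> 'h) \<Rightarrow> bool" where
  "hermitian T \<longleftrightarrow> bounded_clinear T \<and> is_adjoint T T"

definition positive_op :: "('h::complex_inner \<Rightarrow> 'h) \<Rightarrow> bool" where
  "positive_op T \<longleftrightarrow> bounded_clinear T \<and> (\<forall>x. cinner x (T x) \<in> \<real>\<^sub>\<ge>\<^sub>0)"

definition sqrt_op :: "('h::complex_inner \<Rightarrow> 'h) \<Rightarrow> ('h \<Rightarrow> 'h)" where
  "sqrt_op T = (THE P. positive_op P \<and> P \<circ> P = T)"

definition abs_op :: "('h::complex_inner \<Rightarrow> 'h) \<Rightarrow> ('h \<Rightarrow> 'h)" where
  "abs_op T = sqrt_op (cadjoint T \<circ> T)"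

(* Orthonormal bases are taken to be maximal orthonormal sets. *)
definition is_onb :: "'h::complex_inner set \<Rightarrow> bool" where
  "is_onb E \<longleftrightarrow>
     (\<forall>e\<in>E. \<forall>f\<in>E. cinner e f = (if e = f then 1 else 0)) \<and>
     (\<forall>x. (\<forall>e\<in>E. cinner e x = 0) \<longrightarrow> x = 0)"

(* The trace is computed in one fixed orthonormal basis; for trace class operators,
   and for finiteness of the trace of a positive operator, the choice is immaterial. *)
definition some_onb :: "'h::complex_inner set" where
  "some_onb = (SOME E. is_onb E)"

definition op_trace :: "('h::complex_inner \<Rightarrow> 'h) \<Rightarrow> complex" where
  "op_trace T = (\<Sum>\<^sub>\<infinity>e\<in>some_onb. cinner e (T e))"

definition trace_class :: "('h::complex_inner \<Rightarrow> 'h) set" where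
  "trace_class = {T. bounded_clinear T \<and>
                     (\<lambda>e. cinner e (abs_op T e)) summable_on some_onb}"

(* Tr |T| is real and nonnegative for trace class T. *)
definition trace_norm :: "('h::complex_inner \<Rightarrow> 'h) \<Rightarrow> real" where
  "trace_norm T = Re (op_trace (abs_op T))"

(* Linear maps on the space of trace class operators are represented by total functions
   whose values outside trace_class are irrelevant. *)
definition linear_on_trace_class :: "(('h::complex_inner \<Rightarrow> 'h) \<Rightarrow> ('h \<Rightarrow> 'h)) \<Rightarrow> bool" where
  "linear_on_trace_class \<Phi> \<longleftrightarrow>
     (\<forall>X\<in>trace_class. \<Phi> X \<in> trace_class) \<and>
     (\<forall>X\<in>trace_class. \<forall>Y\<in>trace_class. \<Phi> (\<lambda>v. X v + Y v) = (\<lambda>v. \<Phi> X v + \<Phi> Y v)) \<and>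
     (\<forall>c. \<forall>X\<in>trace_class. \<Phi> (\<lambda>v. c *\<^sub>C X v) = (\<lambda>v. c *\<^sub>C \<Phi> X v))"

definition hermiticity_preserving :: "(('h::complex_inner \<Rightarrow> 'h) \<Rightarrow> ('h \<Rightarrow> 'h)) \<Rightarrow> bool" where
  "hermiticity_preserving \<Phi> \<longleftrightarrow> (\<forall>X\<in>trace_class. hermitian X \<longrightarrow> hermitian (\<Phi> X))"

definition trace_preserving :: "(('h::complex_inner \<Rightarrow> 'h) \<Rightarrow> ('h \<Rightarrow> 'h)) \<Rightarrow> bool" where
  "trace_preserving \<Phi> \<longleftrightarrow> (\<forall>X\<in>trace_class. op_trace (\<Phi> X) = op_trace X)"

definition positive_map :: "(('h::complex_inner \<Rightarrow> 'h) \<Rightarrow> ('h \<Rightarrow> 'h)) \<Rightarrow> bool" where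
  "positive_map \<Phi> \<longleftrightarrow> (\<forall>X\<in>trace_class. positive_op X \<longrightarrow> positive_op (\<Phi> X))"

end

theory Submission
  imports Defs
begin

text \<open>
Suppose first that \<open>\<Phi>\<close> is positive. A Hermitian trace class operator \<open>X\<close> is a difference
\<open>A - B\<close> of positive ones with \<open>Tr A + Tr B = \<parallel>X\<parallel>\<^sub>1\<close> (\<open>jordan_decomposition\<close>).
Then \<open>\<Phi> X\<close> is the difference of the positive operators \<open>\<Phi> A\<close> and \<open>\<Phi> B\<close>, so its trace norm is at
most \<open>Tr (\<Phi> A) + Tr (\<Phi> B)\<close> (\<open>trace_norm_le_if_diff_positive\<close>), and this is
\<open>Tr A + Tr B = \<parallel>X\<parallel>\<^sub>1\<close> because \<open>\<Phi>\<close> preserves the trace.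

Conversely, let \<open>\<Phi>\<close> be contractive on Hermitian operators and \<open>X\<close> positive. Then
\<open>\<parallel>\<Phi> X\<parallel>\<^sub>1 \<le> \<parallel>X\<parallel>\<^sub>1 = Tr X = Tr (\<Phi> X)\<close>. A Hermitian operator whose trace is at least its trace
norm equals its absolute value, so \<open>\<Phi> X\<close> is positive (\<open>positive_if_trace_norm_le_trace\<close>).

Both directions rest on the following facts about an operator \<open>Y\<close> and its absolute value \<open>P\<close>, the
positive square root of \<open>Y\<^sup>2\<close>. The operators \<open>P\<close> and \<open>Y\<close> commute, so \<open>(P - Y) (P + Y) = 0\<close>, and
the space splits orthogonally into a part where \<open>Y = P\<close> and a part where \<open>Y = - P\<close>
(\<open>is_abs_eq_neg_on_complement\<close>). Hence \<open>P - Y\<close> and \<open>P + Y\<close> are positive. In an orthonormal basis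
adapted to the splitting, every diagonal entry of \<open>P\<close> is plus or minus that of \<open>Y\<close>, and the
triangle inequality for the trace norm becomes an inequality between diagonal entries
(\<open>trace_abs_diff_le\<close>). The trace is defined through one fixed basis; for positive operators the
change to the adapted basis is justified by Parseval's identity and an exchange of summation
(\<open>psd_trace_basis_independent\<close>).

All of this is done in the underlying real Hilbert space, where symmetric operators replace Hermitian
ones. Complex linearity is recovered at the end from the commutation properties of the square root.
\<close>

section \<open>Symmetric and positive semidefinite operators\<close>

text \<open>Everything up to the last two sections lives in a real Hilbert space. A complex Hilbert space
is a real one under the real part of its inner product, and a bounded complex linear operator is Hermitian, or
positive, exactly if it is symmetric, or positive semidefinite, in the real sense.\<close>

definition symmetric_op :: "('a::real_inner \<Rightarrow> 'a) \<Rightarrow> bool" where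
  "symmetric_op T \<longleftrightarrow> bounded_linear T \<and> (\<forall>x y. inner (T x) y = inner x (T y))"

text \<open>Symmetry is part of positivity because over the reals \<open>0 \<le> inner x (T x)\<close> does not force it.\<close>

definition psd_op :: "('a::real_inner \<Rightarrow> 'a) \<Rightarrow> bool" where
  "psd_op T \<longleftrightarrow> symmetric_op T \<and> (\<forall>x. 0 \<le> inner x (T x))"

lemma symmetric_op_linear: "symmetric_op T \<Longrightarrow> linear T"
  by (simp add: symmetric_op_def bounded_linear.linear)

lemma symmetric_op_bounded_linear: "symmetric_op T \<Longrightarrow> bounded_linear T"
  by (simp add: symmetric_op_def)

lemma symmetric_op_swap: "symmetric_op T \<Longrightarrow> inner (T x) y = inner x (T y)"
  by (simp add: symmetric_op_def)

lemma psd_op_symmetric: "psd_op T \<Longrightarrow> symmetric_op T"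
  by (simp add: psd_op_def)

lemma psd_op_nonneg: "psd_op T \<Longrightarrow> 0 \<le> inner x (T x)"
  by (simp add: psd_op_def)

lemma symmetric_op_diff:
  "symmetric_op S \<Longrightarrow> symmetric_op T \<Longrightarrow> symmetric_op (\<lambda>x. S x - T x)"
  by (simp add: symmetric_op_def bounded_linear_sub inner_diff_left inner_diff_right)

lemma symmetric_op_scaleR:
  "symmetric_op T \<Longrightarrow> symmetric_op (\<lambda>x. c *\<^sub>R T x)"
  by (simp add: symmetric_op_def bounded_linear_compose[OF bounded_linear_scaleR_right])

lemma symmetric_op_id: "symmetric_op (\<lambda>x. x)"
  by (simp add: symmetric_op_def bounded_linear_ident)

text \<open>The form \<open>(x, y) \<mapsto> inner x (T y)\<close> is a possibly degenerate inner product, so the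
quadratic polynomial \<open>t \<mapsto> inner (x + t y) (T (x + t y))\<close> is nonnegative. If its leading
coefficient \<open>c\<close> vanishes, the polynomial is affine and bounded below, hence constant.\<close>

lemma psd_op_cauchy_schwarz:
  assumes "psd_op T"
  shows "(inner x (T y))\<^sup>2 \<le> inner x (T x) * inner y (T y)"
proof -
  have sym: "inner (T u) v = inner u (T v)" for u v
    using assms by (simp add: psd_op_def symmetric_op_def)
  have lin: "linear T"
    using assms by (simp add: psd_op_symmetric symmetric_op_linear)
  define a b c where "a = inner x (T x)" and "b = inner x (T y)" and "c = inner y (T y)"
  have quad: "0 \<le> a + 2 * t * b + t\<^sup>2 * c" for t
  proof -
    have "0 \<le> inner (x + t *\<^sub>R y) (T (x + t *\<^sub>R y))"
      using assms by (rule psd_op_nonneg)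
    also have "\<dots> = a + 2 * t * b + t\<^sup>2 * c"
      using sym[of x y] lin
      by (simp add: a_def b_def c_def linear_add linear_scale inner_add_left inner_add_right
          power2_eq_square algebra_simps inner_commute)
    finally show ?thesis .
  qed
  have "c \<ge> 0"
    using assms by (simp add: c_def psd_op_nonneg)
  show ?thesis
  proof (cases "c = 0")
    case True
    have "b = 0"
    proof (rule ccontr)
      assume "b \<noteq> 0"
      then show False
        using quad[of "- (a + 1) / (2 * b)"] True by (simp add: field_simps)
    qed
    then show ?thesis
      using True by (simp add: b_def c_def)
  next
    case False
    with \<open>c \<ge> 0\<close> have "c > 0" by simp
    have "0 \<le> a - b\<^sup>2 / c"
      using quad[of "- b / c"] \<open>c > 0\<close> by (simp add: field_simps power2_eq_square)
    then have "b\<^sup>2 \<le> a * c"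
      using \<open>c > 0\<close> by (simp add: field_simps)
    then show ?thesis
      by (simp add: a_def b_def c_def)
  qed
qed

lemma psd_op_eq_0:
  assumes "psd_op T" "inner x (T x) = 0"
  shows "T x = 0"
proof -
  have "(inner (T x) (T x))\<^sup>2 \<le> inner (T x) (T (T x)) * inner x (T x)"
    using psd_op_cauchy_schwarz[OF assms(1)] .
  then show ?thesis
    using assms(2) by simp
qed

text \<open>Cauchy-Schwarz for the form of \<open>T\<close>, applied to \<open>T x\<close> and \<open>x\<close>, turns a bound on the
quadratic form into a bound on the operator norm.\<close>

lemma psd_op_contraction:
  assumes "psd_op T" and le: "\<And>x. inner x (T x) \<le> (norm x)\<^sup>2"
  shows "norm (T x) \<le> norm x"
proof (cases "T x = 0")
  case False
  have "((norm (T x))\<^sup>2)\<^sup>2 = (inner (T x) (T x))\<^sup>2"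
    by (simp add: power2_norm_eq_inner)
  also have "\<dots> \<le> inner (T x) (T (T x)) * inner x (T x)"
    using psd_op_cauchy_schwarz[OF assms(1)] .
  also have "\<dots> \<le> (norm (T x))\<^sup>2 * (norm x)\<^sup>2"
    by (intro mult_mono le psd_op_nonneg assms(1)) simp
  finally have "(norm (T x))\<^sup>2 \<le> (norm x)\<^sup>2"
    using False by (simp add: power2_eq_square)
  then show ?thesis
    by simp
qed simp

section \<open>The positive square root\<close>

text \<open>With \<open>T = 1 - B\<close> and \<open>S = 1 - Y\<close>, the equation \<open>S\<^sup>2 = T\<close> becomes the fixed point equation
\<open>Y = (B + Y\<^sup>2) / 2\<close>, solved here by iteration from \<open>0\<close>. All iterates are polynomials in
\<open>B\<close>, so the limit inherits symmetry and commutes with whatever commutes with \<open>B\<close>.\<close>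

fun sqrt_iter :: "('a::real_normed_vector \<Rightarrow>\<^sub>L 'a) \<Rightarrow> nat \<Rightarrow> ('a \<Rightarrow>\<^sub>L 'a)" where
  "sqrt_iter B 0 = 0"
| "sqrt_iter B (Suc n) = (1/2) *\<^sub>R (B + (sqrt_iter B n o\<^sub>L sqrt_iter B n))"

text \<open>The same iteration for the scalar \<open>B = 1\<close>. The iterates have nonnegative coefficients as
polynomials in \<open>B\<close>, and so have their successive differences; hence for \<open>norm B \<le> 1\<close> the
scalar sequence dominates the operator sequence term by term and difference by difference.\<close>

fun sqrt_majorant :: "nat \<Rightarrow> real" where
  "sqrt_majorant 0 = 0"
| "sqrt_majorant (Suc n) = (1 + (sqrt_majorant n)\<^sup>2) / 2"

lemma sqrt_majorant_bounds: "0 \<le> sqrt_majorant n \<and> sqrt_majorant n \<le> 1"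
proof (induction n)
  case (Suc n)
  then have "(sqrt_majorant n)\<^sup>2 \<le> 1"
    by (simp add: power_le_one)
  then show ?case by simp
qed simp

lemma sqrt_majorant_mono: "incseq sqrt_majorant"
proof (rule incseq_SucI)
  fix n
  have "0 \<le> (1 - sqrt_majorant n)\<^sup>2"
    by simp
  then show "sqrt_majorant n \<le> sqrt_majorant (Suc n)"
    by (simp add: power2_eq_square algebra_simps)
qed

lemma norm_sqrt_iter_le:
  assumes "norm B \<le> 1"
  shows "norm (sqrt_iter B n) \<le> sqrt_majorant n"
proof (induction n)
  case (Suc n)
  have "norm (B + (sqrt_iter B n o\<^sub>L sqrt_iter B n)) \<le> 1 + sqrt_majorant n * sqrt_majorant n"
    using assms Suc sqrt_majorant_bounds[of n]
    by (intro norm_triangle_le add_mono order_trans[OF norm_blinfun_compose] mult_mono) auto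
  then show ?case
    by (simp add: power2_eq_square)
qed simp

lemma norm_sqrt_iter_diff_le:
  assumes "norm B \<le> 1"
  shows "norm (sqrt_iter B (Suc n) - sqrt_iter B n) \<le> sqrt_majorant (Suc n) - sqrt_majorant n"
proof (induction n)
  case 0
  then show ?case using assms by simp
next
  case (Suc n)
  define U V where "U = sqrt_iter B (Suc n)" and "V = sqrt_iter B n"
  define u v where "u = sqrt_majorant (Suc n)" and "v = sqrt_majorant n"
  have UV: "norm (U - V) \<le> u - v"
    using Suc by (simp only: U_def V_def u_def v_def)
  have U: "norm U \<le> u" and V: "norm V \<le> v"
    using norm_sqrt_iter_le[OF assms] by (simp_all only: U_def V_def u_def v_def)
  \<comment> \<open>This way of splitting the difference of squares works without commuting \<open>U\<close> and \<open>V\<close>.\<close>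
  have "(U o\<^sub>L U) - (V o\<^sub>L V) = (U o\<^sub>L (U - V)) + ((U - V) o\<^sub>L V)"
    by (rule blinfun_eqI) (simp add: blinfun.bilinear_simps)
  moreover have "norm (U o\<^sub>L (U - V)) \<le> u * (u - v)"
    using U UV by (intro order_trans[OF norm_blinfun_compose] mult_mono') auto
  moreover have "norm ((U - V) o\<^sub>L V) \<le> (u - v) * v"
    using V UV by (intro order_trans[OF norm_blinfun_compose] mult_mono') auto
  ultimately have "norm ((U o\<^sub>L U) - (V o\<^sub>L V)) \<le> u * (u - v) + (u - v) * v"
    by (metis add_mono norm_triangle_le)
  moreover have "sqrt_iter B (Suc (Suc n)) - sqrt_iter B (Suc n)
      = (1/2) *\<^sub>R ((U o\<^sub>L U) - (V o\<^sub>L V))"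
    unfolding U_def V_def by (simp add: algebra_simps)
  moreover have "sqrt_majorant (Suc (Suc n)) - sqrt_majorant (Suc n)
      = (u * (u - v) + (u - v) * v) / 2"
    unfolding u_def v_def by (simp add: power2_eq_square field_simps)
  ultimately show ?case
    by simp
qed

lemma norm_sqrt_iter_dist_le:
  assumes "norm B \<le> 1" "m \<le> n"
  shows "norm (sqrt_iter B n - sqrt_iter B m) \<le> sqrt_majorant n - sqrt_majorant m"
  using assms(2)
proof (induction n rule: dec_induct)
  case (step n)
  have "norm (sqrt_iter B (Suc n) - sqrt_iter B m)
      \<le> norm (sqrt_iter B (Suc n) - sqrt_iter B n) + norm (sqrt_iter B n - sqrt_iter B m)"
    by (rule norm_diff_triangle_le) (rule order_refl)+
  then show ?case
    using step.IH norm_sqrt_iter_diff_le[OF assms(1), of n] by linarith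
qed simp

text \<open>The scalar iteration is monotone and bounded by \<open>1\<close>, hence Cauchy, and it dominates the
distances of the operator iterates. So these converge in operator norm, even when \<open>norm B = 1\<close>,
where the iteration map is not a contraction.\<close>

lemma sqrt_iter_limit:
  fixes B :: "'a::banach \<Rightarrow>\<^sub>L 'a"
  assumes "norm B \<le> 1"
  obtains Y where "sqrt_iter B \<longlonglongrightarrow> Y" "norm Y \<le> 1" "2 *\<^sub>R Y = B + (Y o\<^sub>L Y)"
proof -
  have "convergent sqrt_majorant"
    using sqrt_majorant_mono sqrt_majorant_bounds
    by (metis incseq_convergent convergentI)
  then have "Cauchy sqrt_majorant"
    by (rule convergent_Cauchy)
  have "Cauchy (sqrt_iter B)"
  proof (rule CauchyI')
    fix e :: real assume "e > 0"
    then obtain M where M: "\<And>m n. m \<ge> M \<Longrightarrow> n \<ge> M \<Longrightarrow>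
        norm (sqrt_majorant m - sqrt_majorant n) < e"
      using \<open>Cauchy sqrt_majorant\<close> by (meson CauchyD)
    have "dist (sqrt_iter B m) (sqrt_iter B n) < e" if "m \<ge> M" "n > m" for m n
      using norm_sqrt_iter_dist_le[OF assms, of m n] M[of n m] that
      by (simp add: dist_norm norm_minus_commute)
    then show "\<exists>M. \<forall>m\<ge>M. \<forall>n>m. dist (sqrt_iter B m) (sqrt_iter B n) < e"
      by blast
  qed
  then obtain Y where Y: "sqrt_iter B \<longlonglongrightarrow> Y"
    using Cauchy_convergent[of "sqrt_iter B"] by (auto simp: convergent_def)
  have "norm (sqrt_iter B n) \<le> 1" for n
    using norm_sqrt_iter_le[OF assms, of n] sqrt_majorant_bounds[of n] by linarith
  then have "norm Y \<le> 1"
    by (intro Lim_bounded[OF tendsto_norm[OF Y], of 0]) auto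
  have "(\<lambda>n. sqrt_iter B (Suc n)) \<longlonglongrightarrow> (1/2) *\<^sub>R (B + (Y o\<^sub>L Y))"
    unfolding sqrt_iter.simps
    by (intro tendsto_intros bounded_bilinear.tendsto[OF bounded_bilinear_blinfun_compose] Y)
  then have "Y = (1/2) *\<^sub>R (B + (Y o\<^sub>L Y))"
    using LIMSEQ_Suc[OF Y] LIMSEQ_unique by blast
  then have "2 *\<^sub>R Y = 2 *\<^sub>R ((1/2) *\<^sub>R (B + (Y o\<^sub>L Y)))"
    by simp
  then have "2 *\<^sub>R Y = B + (Y o\<^sub>L Y)"
    by simp
  with Y \<open>norm Y \<le> 1\<close> show thesis
    by (rule that)
qed

lemma sqrt_iter_symmetric:
  assumes "\<And>x y. inner (blinfun_apply B x) y = inner x (B y)"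
  shows "inner (sqrt_iter B n x) y = inner x (sqrt_iter B n y)"
  by (induction n arbitrary: x y)
    (simp_all add: blinfun.bilinear_simps inner_add_left inner_add_right assms)

lemma sqrt_iter_commute:
  assumes "linear C" "\<And>x. C (blinfun_apply B x) = B (C x)"
  shows "C (sqrt_iter B n x) = sqrt_iter B n (C x)"
  by (induction n arbitrary: x)
    (simp_all add: blinfun.bilinear_simps linear_add linear_scale linear_0 assms)

text \<open>After scaling, \<open>B = 1 - T / K\<close> satisfies \<open>0 \<le> B \<le> 1\<close> and is a contraction; the square root
is \<open>sqrt K * (1 - Y)\<close> for the limit \<open>Y\<close> of the iteration. The commutation property is part of
the result because it yields complex linearity of the root, its uniqueness, and the fact that an
operator commutes with its absolute value.\<close>

lemma psd_op_sqrt_exists: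
  fixes T :: "'a::{real_inner,banach} \<Rightarrow> 'a"
  assumes "psd_op T"
  obtains S where "psd_op S" "S \<circ> S = T"
    "\<And>C. bounded_linear C \<Longrightarrow> C \<circ> T = T \<circ> C \<Longrightarrow> C \<circ> S = S \<circ> C"
proof -
  have T: "bounded_linear T"
    using assms by (simp add: psd_op_def symmetric_op_def)
  obtain K where "K > 0" and K: "\<And>x. norm (T x) \<le> norm x * K"
    using bounded_linear.pos_bounded[OF T] by blast
  define b where "b = (\<lambda>x. x - (1/K) *\<^sub>R T x)"
  have sym_b: "symmetric_op b"
    unfolding b_def
    by (intro symmetric_op_diff symmetric_op_scaleR symmetric_op_id psd_op_symmetric assms)
  have T_le: "inner x (T x) \<le> K * inner x x" for x
  proof -
    have "inner x (T x) \<le> norm x * norm (T x)"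
      by (rule norm_cauchy_schwarz)
    also have "\<dots> \<le> norm x * (norm x * K)"
      by (intro mult_left_mono K) simp
    also have "\<dots> = K * inner x x"
      by (simp add: dot_square_norm power2_eq_square)
    finally show ?thesis .
  qed
  have inner_b: "inner x (b x) = inner x x - inner x (T x) / K" for x
    by (simp add: b_def inner_diff_right)
  have psd_b: "psd_op b"
    using T_le \<open>K > 0\<close> sym_b by (simp add: psd_op_def inner_b field_simps)
  have norm_b: "norm (b x) \<le> norm x" for x
    using psd_b
  proof (rule psd_op_contraction)
    show "inner x (b x) \<le> (norm x)\<^sup>2" for x
      using psd_op_nonneg[OF assms, of x] \<open>K > 0\<close> by (simp add: inner_b dot_square_norm)
  qed
  define B where "B = Blinfun b"
  have B: "blinfun_apply B = b"
    unfolding B_def by (rule bounded_linear_Blinfun_apply[OF symmetric_op_bounded_linear[OF sym_b]])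
  have "norm B \<le> 1"
    by (rule norm_blinfun_bound) (simp_all add: B norm_b)
  then obtain Y where lim: "sqrt_iter B \<longlonglongrightarrow> Y" and "norm Y \<le> 1"
    and Y: "2 *\<^sub>R Y = B + (Y o\<^sub>L Y)"
    using sqrt_iter_limit by blast
  have lim_at: "(\<lambda>n. sqrt_iter B n x) \<longlonglongrightarrow> Y x" for x
    by (intro tendsto_intros lim)
  define S where "S = (\<lambda>x. sqrt K *\<^sub>R (x - Y x))"
  have "(\<lambda>n. inner (sqrt_iter B n x) y) \<longlonglongrightarrow> inner (Y x) y"
    "(\<lambda>n. inner x (sqrt_iter B n y)) \<longlonglongrightarrow> inner x (Y y)" for x y
    by (intro tendsto_intros lim_at)+
  then have "inner (Y x) y = inner x (Y y)" for x y
    using sqrt_iter_symmetric[of B] symmetric_op_swap[OF sym_b] LIMSEQ_unique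
    by (simp add: B) blast
  then have "symmetric_op (blinfun_apply Y)"
    by (simp add: symmetric_op_def blinfun.bounded_linear_right)
  then have "symmetric_op S"
    unfolding S_def by (intro symmetric_op_scaleR symmetric_op_diff symmetric_op_id)
  moreover have "0 \<le> inner x (S x)" for x
  proof -
    have "inner x (Y x) \<le> norm x * norm (Y x)"
      by (rule norm_cauchy_schwarz)
    also have "\<dots> \<le> norm x * (1 * norm x)"
      using norm_blinfun[of Y x] \<open>norm Y \<le> 1\<close>
      by (intro mult_left_mono order_trans[OF norm_blinfun] mult_right_mono) auto
    finally show ?thesis
      using \<open>K > 0\<close> by (simp add: S_def inner_diff_right dot_square_norm power2_eq_square)
  qed
  ultimately have "psd_op S"
    by (simp add: psd_op_def)
  moreover have "S \<circ> S = T"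
  proof
    fix x
    have "2 *\<^sub>R Y x = b x + Y (Y x)"
      using arg_cong[OF Y, of "\<lambda>Z. blinfun_apply Z x"] by (simp add: blinfun.bilinear_simps B)
    then have "x - Y x - (Y x - Y (Y x)) = (1/K) *\<^sub>R T x"
      by (simp add: b_def scaleR_2 algebra_simps)
    moreover have "S (S x) = K *\<^sub>R (x - Y x - (Y x - Y (Y x)))"
      using \<open>K > 0\<close>
      by (simp add: S_def blinfun.bilinear_simps flip: scaleR_diff_right)
    ultimately show "(S \<circ> S) x = T x"
      using \<open>K > 0\<close> by simp
  qed
  moreover have "C \<circ> S = S \<circ> C" if C: "bounded_linear C" and CT: "C \<circ> T = T \<circ> C" for C
  proof
    fix x
    have lin: "linear C"
      using C by (rule bounded_linear.linear)
    have "C (T y) = T (C y)" for y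
      using fun_cong[OF CT, of y] by simp
    then have "C (B y) = B (C y)" for y
      by (simp add: B b_def linear_diff[OF lin] linear_scale[OF lin])
    then have "(\<lambda>n. C (sqrt_iter B n x)) \<longlonglongrightarrow> Y (C x)"
      using lim_at by (simp add: sqrt_iter_commute[OF lin])
    moreover have "(\<lambda>n. C (sqrt_iter B n x)) \<longlonglongrightarrow> C (Y x)"
      by (intro bounded_linear.tendsto[OF C] lim_at)
    ultimately have "C (Y x) = Y (C x)"
      using LIMSEQ_unique by blast
    then show "(C \<circ> S) x = (S \<circ> C) x"
      by (simp add: S_def linear_diff[OF lin] linear_scale[OF lin])
  qed
  ultimately show thesis
    by (rule that)
qed

lemma psd_op_square:
  assumes "symmetric_op Y"
  shows "psd_op (Y \<circ> Y)"
  using assms bounded_linear_compose[of Y Y]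
  by (simp add: psd_op_def symmetric_op_def comp_def) (metis inner_ge_zero)

text \<open>Let \<open>S\<close> be the root constructed above and \<open>R\<close> any root. They commute, because \<open>R\<close>
commutes with \<open>R\<^sup>2\<close>, so \<open>(S + R) (S - R) = S\<^sup>2 - R\<^sup>2 = 0\<close>. For \<open>y = (S - R) x\<close> both forms \<open>inner y (S y)\<close> and
\<open>inner y (R y)\<close> are nonnegative with sum \<open>0\<close>; therefore \<open>S y = R y = 0\<close> and
\<open>inner y y = inner x ((S - R) y) = 0\<close>.\<close>

lemma psd_op_sqrt_unique:
  fixes P Q :: "'a::{real_inner,banach} \<Rightarrow> 'a"
  assumes "psd_op P" "psd_op Q" "P \<circ> P = Q \<circ> Q"
  shows "P = Q"
proof -
  obtain S where S: "psd_op S" "S \<circ> S = Q \<circ> Q"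
    and comm: "\<And>C. bounded_linear C \<Longrightarrow> C \<circ> (Q \<circ> Q) = (Q \<circ> Q) \<circ> C \<Longrightarrow> C \<circ> S = S \<circ> C"
    using psd_op_sqrt_exists[OF psd_op_square[OF psd_op_symmetric[OF assms(2)]]] by blast
  have "R = S" if R: "psd_op R" "R \<circ> R = Q \<circ> Q" for R
  proof
    fix x
    have lin: "linear R" "linear S"
      using R(1) S(1) by (simp_all add: psd_op_symmetric symmetric_op_linear)
    have RR: "R (R y) = S (S y)" for y
      using R(2) S(2) by (metis comp_apply)
    have "R \<circ> S = S \<circ> R"
      using R symmetric_op_bounded_linear[OF psd_op_symmetric[OF R(1)]]
      by (intro comm) (auto simp flip: R(2) simp: comp_assoc)
    then have RS: "R (S y) = S (R y)" for y
      by (metis comp_apply)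
    define y where "y = S x - R x"
    have "S y + R y = 0"
      by (simp add: y_def linear_diff[OF lin(1)] linear_diff[OF lin(2)] RR RS)
    then have "inner y (S y) + inner y (R y) = 0"
      by (metis inner_add_right inner_zero_right)
    then have "inner y (S y) = 0" "inner y (R y) = 0"
      using psd_op_nonneg[OF R(1), of y] psd_op_nonneg[OF S(1), of y] by linarith+
    then have "S y = 0" "R y = 0"
      using psd_op_eq_0 R(1) S(1) by blast+
    then have "inner x (S y - R y) = 0"
      by simp
    then have "inner y y = 0"
      using symmetric_op_swap[OF psd_op_symmetric[OF R(1)], of x y]
        symmetric_op_swap[OF psd_op_symmetric[OF S(1)], of x y]
      by (simp add: y_def inner_diff_left inner_diff_right inner_commute)
    then show "R x = S x"
      by (simp add: y_def)
  qed
  then show ?thesis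
    using assms by metis
qed

section \<open>Orthogonal projection and orthonormal bases\<close>

lemma closure_subspace:
  fixes W :: "'a::real_normed_vector set"
  assumes "subspace W"
  shows "subspace (closure W)"
proof (rule subspaceI)
  show "0 \<in> closure W"
    using assms closure_subset subspace_0 by blast
next
  fix x y assume "x \<in> closure W" "y \<in> closure W"
  then obtain f g where "\<And>n. f n \<in> W" "f \<longlonglongrightarrow> x" "\<And>n. g n \<in> W" "g \<longlonglongrightarrow> y"
    by (auto simp: closure_sequential)
  then show "x + y \<in> closure W"
    unfolding closure_sequential
    by (intro exI[of _ "\<lambda>n. f n + g n"]) (auto intro: tendsto_add subspace_add[OF assms])
next
  fix x and c :: real assume "x \<in> closure W"
  then obtain f where "\<And>n. f n \<in> W" "f \<longlonglongrightarrow> x"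
    by (auto simp: closure_sequential)
  then show "c *\<^sub>R x \<in> closure W"
    unfolding closure_sequential
    by (intro exI[of _ "\<lambda>n. c *\<^sub>R f n"])
      (auto intro: tendsto_scaleR tendsto_const subspace_scale[OF assms])
qed

text \<open>A sequence in \<open>W\<close> that minimises the distance to \<open>x\<close> is Cauchy by the parallelogram law,
since midpoints of its members stay in \<open>W\<close>. At the closest point \<open>w\<close> the distance cannot
decrease in any direction \<open>u\<close> of \<open>W\<close>, which makes \<open>x - w\<close> orthogonal to \<open>u\<close>.\<close>

lemma orthogonal_projection_exists:
  fixes W :: "'a::{real_inner,banach} set"
  assumes "subspace W" "closed W"
  obtains w where "w \<in> W" "\<And>u. u \<in> W \<Longrightarrow> inner u (x - w) = 0"
proof -
  define d where "d = infdist x W"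
  have "W \<noteq> {}"
    using assms(1) subspace_0 by blast
  have "\<exists>w\<in>W. dist x w < d + 1 / Suc n" for n
  proof -
    have "(INF w\<in>W. dist x w) < d + 1 / Suc n"
      using \<open>W \<noteq> {}\<close> by (simp add: d_def infdist_notempty)
    then show ?thesis
      using \<open>W \<noteq> {}\<close> by (subst (asm) cINF_less_iff) (auto intro: bdd_belowI2[of _ 0])
  qed
  then obtain f where fW: "\<And>n. f n \<in> W" and fd: "\<And>n. dist x (f n) < d + 1 / Suc n"
    by metis
  have d_le: "d \<le> norm (x - w)" if "w \<in> W" for w
    using infdist_le[OF that, of x] by (simp add: d_def dist_norm)
  have "d \<ge> 0"
    by (simp add: d_def infdist_nonneg)
  define s where "s = (\<lambda>n. 4 * ((d + 1 / Suc n)\<^sup>2 - d\<^sup>2))"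
  have close: "(norm (f m - f n))\<^sup>2 \<le> s k" if "k \<le> m" "k \<le> n" for k m n
  proof -
    have sq: "(norm (x - f i))\<^sup>2 \<le> (d + 1 / Suc k)\<^sup>2" if "k \<le> i" for i
    proof (rule power_mono)
      have "1 / real (Suc i) \<le> 1 / real (Suc k)"
        using that by (simp add: field_simps)
      then show "norm (x - f i) \<le> d + 1 / Suc k"
        using fd[of i] by (simp add: dist_norm)
    qed simp
    have "(1/2) *\<^sub>R (f m + f n) \<in> W"
      using fW assms(1) by (intro subspace_scale subspace_add)
    then have "d\<^sup>2 \<le> (norm (x - (1/2) *\<^sub>R (f m + f n)))\<^sup>2"
      using d_le \<open>d \<ge> 0\<close> by (intro power_mono) auto
    moreover have "(norm (f m - f n))\<^sup>2 = 2 * (norm (x - f m))\<^sup>2 + 2 * (norm (x - f n))\<^sup>2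
        - 4 * (norm (x - (1/2) *\<^sub>R (f m + f n)))\<^sup>2"
      by (simp add: power2_norm_eq_inner inner_diff_left inner_diff_right inner_add_left
          inner_add_right inner_commute algebra_simps)
    ultimately show ?thesis
      using sq[OF that(1)] sq[OF that(2)] by (simp add: s_def)
  qed
  have "(\<lambda>n. 1 / real (Suc n)) \<longlonglongrightarrow> 0"
    using LIMSEQ_inverse_real_of_nat by (simp add: inverse_eq_divide)
  then have "s \<longlonglongrightarrow> 4 * ((d + 0)\<^sup>2 - d\<^sup>2)"
    unfolding s_def by (intro tendsto_intros)
  then have "s \<longlonglongrightarrow> 0"
    by simp
  have "Cauchy f"
  proof (rule CauchyI)
    fix e :: real assume "e > 0"
    then obtain k where "s k < e\<^sup>2"
      using order_tendstoD(2)[OF \<open>s \<longlonglongrightarrow> 0\<close>, of "e\<^sup>2"] by (auto simp: eventually_sequentially)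
    then have "norm (f m - f n) < e" if "k \<le> m" "k \<le> n" for m n
      using close[OF that] \<open>e > 0\<close> by (intro power2_less_imp_less[of _ e]) auto
    then show "\<exists>M. \<forall>m\<ge>M. \<forall>n\<ge>M. norm (f m - f n) < e"
      by blast
  qed
  then obtain w where fw: "f \<longlonglongrightarrow> w"
    using Cauchy_convergent[of f] by (auto simp: convergent_def)
  then have "w \<in> W"
    using fW assms(2) by (metis closed_sequentially)
  have "(\<lambda>n. norm (x - f n)) \<longlonglongrightarrow> norm (x - w)"
    by (intro tendsto_intros fw)
  moreover have "(\<lambda>n. d + 1 / Suc n) \<longlonglongrightarrow> d + 0"
    by (intro tendsto_intros) fact
  ultimately have "norm (x - w) \<le> d"
    using fd by (intro LIMSEQ_le[of _ _ "\<lambda>n. d + 1 / Suc n" d])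
      (auto simp: dist_norm intro!: less_imp_le)
  have "inner u (x - w) = 0" if "u \<in> W" for u
  proof (cases "u = 0")
    case False
    \<comment> \<open>The minimiser of \<open>norm (x - w - t u)\<close> over real \<open>t\<close>.\<close>
    define t where "t = inner u (x - w) / inner u u"
    have "w + t *\<^sub>R u \<in> W"
      using \<open>w \<in> W\<close> that assms(1) by (intro subspace_add subspace_scale)
    then have "norm (x - w) \<le> norm (x - (w + t *\<^sub>R u))"
      using d_le \<open>norm (x - w) \<le> d\<close> order_trans by blast
    then have "(norm (x - w))\<^sup>2 \<le> (norm ((x - w) - t *\<^sub>R u))\<^sup>2"
      by (simp add: diff_diff_eq)
    also have "\<dots> = (norm (x - w))\<^sup>2 - (inner u (x - w))\<^sup>2 / inner u u"
      using False unfolding power2_norm_eq_inner inner_diff_left[of "x - w"]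
        inner_diff_right[of _ "x - w"] inner_scaleR_left inner_scaleR_right
      by (simp add: t_def inner_commute[of "x - w" u] power2_eq_square)
    finally have "(inner u (x - w))\<^sup>2 / inner u u \<le> 0"
      by simp
    then show ?thesis
      using False inner_gt_zero_iff[of u] by (simp add: divide_le_0_iff del: inner_gt_zero_iff)
  qed simp
  with \<open>w \<in> W\<close> show thesis
    by (rule that)
qed

definition orthonormal :: "'a::real_inner set \<Rightarrow> bool" where
  "orthonormal E \<longleftrightarrow> pairwise orthogonal E \<and> (\<forall>e\<in>E. norm e = 1)"

text \<open>Completeness is stated as maximality of the orthonormal set, as for complex bases; that
expansions converge is a theorem in a complete space.\<close>

definition real_onb :: "'a::real_inner set \<Rightarrow> bool" where
  "real_onb E \<longleftrightarrow> orthonormal E \<and> (\<forall>x. (\<forall>e\<in>E. inner e x = 0) \<longrightarrow> x = 0)"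

lemma real_onb_eq_0: "real_onb E \<Longrightarrow> (\<And>e. e \<in> E \<Longrightarrow> inner e x = 0) \<Longrightarrow> x = 0"
  by (simp add: real_onb_def)

text \<open>Among all combinations of the vectors in \<open>F\<close>, the one with the Fourier coefficients is
closest to \<open>x\<close>. The identity gives Bessel's inequality (take \<open>c e = inner e x\<close>) and also a lower
bound for the sum of the squared coefficients in terms of any approximation of \<open>x\<close>.\<close>

lemma orthonormal_norm_diff:
  assumes "orthonormal E" "finite F" "F \<subseteq> E"
  shows "(norm (x - (\<Sum>e\<in>F. c e *\<^sub>R e)))\<^sup>2
    = (norm x)\<^sup>2 - (\<Sum>e\<in>F. (inner e x)\<^sup>2) + (\<Sum>e\<in>F. (c e - inner e x)\<^sup>2)"
proof -
  have "pairwise (\<lambda>e f. orthogonal (c e *\<^sub>R e) (c f *\<^sub>R f)) F"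
    using assms pairwise_subset[of orthogonal E F]
    by (auto simp: orthonormal_def pairwise_def orthogonal_def)
  then have "(norm (\<Sum>e\<in>F. c e *\<^sub>R e))\<^sup>2 = (\<Sum>e\<in>F. (norm (c e *\<^sub>R e))\<^sup>2)"
    by (rule norm_sum_Pythagorean[OF assms(2)])
  also have "\<dots> = (\<Sum>e\<in>F. (c e)\<^sup>2)"
    using assms by (intro sum.cong) (auto simp: orthonormal_def subset_iff)
  finally have *: "(norm (\<Sum>e\<in>F. c e *\<^sub>R e))\<^sup>2 = (\<Sum>e\<in>F. (c e)\<^sup>2)" .
  have "(norm (x - (\<Sum>e\<in>F. c e *\<^sub>R e)))\<^sup>2
      = (norm x)\<^sup>2 - 2 * inner x (\<Sum>e\<in>F. c e *\<^sub>R e) + (norm (\<Sum>e\<in>F. c e *\<^sub>R e))\<^sup>2"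
    by (simp add: power2_norm_eq_inner inner_diff_left inner_diff_right inner_commute)
  also have "\<dots> = (norm x)\<^sup>2 - 2 * (\<Sum>e\<in>F. c e * inner e x) + (\<Sum>e\<in>F. (c e)\<^sup>2)"
    unfolding * by (simp add: inner_sum_right inner_commute)
  also have "\<dots> = (norm x)\<^sup>2 - (\<Sum>e\<in>F. (inner e x)\<^sup>2) + (\<Sum>e\<in>F. (c e - inner e x)\<^sup>2)"
    by (simp add: power2_diff sum.distrib sum_subtractf sum_distrib_left mult.assoc)
  finally show ?thesis .
qed

lemma real_onb_span_dense:
  fixes E :: "'a::{real_inner,banach} set"
  assumes "real_onb E"
  shows "x \<in> closure (span E)"
proof -
  obtain w where w: "w \<in> closure (span E)" "\<And>u. u \<in> closure (span E) \<Longrightarrow> inner u (x - w) = 0"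
    using orthogonal_projection_exists[OF closure_subspace[OF subspace_span] closed_closure] by blast
  have "x - w = 0"
    using assms
  proof (rule real_onb_eq_0)
    fix e assume "e \<in> E"
    then show "inner e (x - w) = 0"
      using w(2) closure_subset span_base by blast
  qed
  then show ?thesis
    using w(1) by simp
qed

lemma parseval:
  fixes E :: "'a::{real_inner,banach} set"
  assumes "real_onb E"
  shows "((\<lambda>e. (inner e x)\<^sup>2) has_sum (norm x)\<^sup>2) E"
proof -
  have on: "orthonormal E"
    using assms by (simp add: real_onb_def)
  have bessel: "(\<Sum>e\<in>F. (inner e x)\<^sup>2) \<le> (norm x)\<^sup>2" if "finite F" "F \<subseteq> E" for F
  proof -
    have "0 \<le> (norm (x - (\<Sum>e\<in>F. inner e x *\<^sub>R e)))\<^sup>2"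
      by simp
    then show ?thesis
      unfolding orthonormal_norm_diff[OF on that] by simp
  qed
  define \<Sigma> where "\<Sigma> = (SUP F\<in>{F. finite F \<and> F \<subseteq> E}. \<Sum>e\<in>F. (inner e x)\<^sup>2)"
  have bdd: "bdd_above ((\<lambda>F. \<Sum>e\<in>F. (inner e x)\<^sup>2) ` {F. finite F \<and> F \<subseteq> E})"
    using bessel by (intro bdd_aboveI2[of _ _ "(norm x)\<^sup>2"]) auto
  have sum: "((\<lambda>e. (inner e x)\<^sup>2) has_sum \<Sigma>) E"
    unfolding \<Sigma>_def using bdd by (intro nonneg_bdd_above_has_sum) (simp_all add: conj_commute)
  have "\<Sigma> \<le> (norm x)\<^sup>2"
    unfolding \<Sigma>_def using bessel by (intro cSUP_least) auto
  moreover have "(norm x)\<^sup>2 \<le> \<Sigma>"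
  proof (rule field_le_epsilon)
    fix \<epsilon> :: real assume "\<epsilon> > 0"
    then obtain y where "y \<in> span E" and y: "dist y x < sqrt \<epsilon>"
      using real_onb_span_dense[OF assms, of x] by (metis closure_approachable real_sqrt_gt_zero)
    then obtain F c where F: "finite F" "F \<subseteq> E" and y_eq: "y = (\<Sum>e\<in>F. c e *\<^sub>R e)"
      by (auto simp: span_explicit)
    have "(norm (x - y))\<^sup>2 \<le> (sqrt \<epsilon>)\<^sup>2"
      using y by (intro power_mono) (auto simp: dist_norm norm_minus_commute)
    moreover have "0 \<le> (\<Sum>e\<in>F. (c e - inner e x)\<^sup>2)"
      by (intro sum_nonneg) simp
    ultimately have "(norm x)\<^sup>2 \<le> (\<Sum>e\<in>F. (inner e x)\<^sup>2) + \<epsilon>"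
      using \<open>\<epsilon> > 0\<close> unfolding y_eq orthonormal_norm_diff[OF on F] by simp
    also have "(\<Sum>e\<in>F. (inner e x)\<^sup>2) \<le> \<Sigma>"
      unfolding \<Sigma>_def using F bdd by (intro cSUP_upper) auto
    finally show "(norm x)\<^sup>2 \<le> \<Sigma> + \<epsilon>"
      by simp
  qed
  ultimately show ?thesis
    using sum by simp
qed

text \<open>Zorn's lemma in the form that gives both complex orthonormal bases and real ones with
members restricted to a prescribed set \<open>S\<close>. For orthogonality of unit vectors the last conclusion
says that no unit vector in \<open>S\<close> is orthogonal to all of \<open>E\<close>.\<close>

lemma maximal_pairwise_subset:
  assumes sym: "\<And>x y. R x y \<Longrightarrow> R y x"
  obtains E where "E \<subseteq> S" "pairwise R E"
    "\<And>x. x \<in> S \<Longrightarrow> (\<And>e. e \<in> E \<Longrightarrow> R e x) \<Longrightarrow> x \<in> E"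
proof -
  define \<A> where "\<A> = {E. E \<subseteq> S \<and> pairwise R E}"
  have "\<exists>M\<in>\<A>. \<forall>X\<in>\<A>. M \<subseteq> X \<longrightarrow> X = M"
  proof (rule subset_Zorn_nonempty)
    show "\<A> \<noteq> {}"
      by (auto simp: \<A>_def intro: exI[of _ "{}"])
    fix \<C> assume "subset.chain \<A> \<C>"
    then show "\<Union>\<C> \<in> \<A>"
      using pairwise_chain_Union[of \<C> R] by (auto simp: \<A>_def subset_chain_def chain_subset_def)
  qed
  then obtain E where E: "E \<subseteq> S" "pairwise R E"
    and max: "\<And>X. X \<subseteq> S \<Longrightarrow> pairwise R X \<Longrightarrow> E \<subseteq> X \<Longrightarrow> X = E"
    by (auto simp: \<A>_def)
  have "x \<in> E" if "x \<in> S" "\<And>e. e \<in> E \<Longrightarrow> R e x" for x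
  proof -
    have "insert x E = E"
      using E that sym by (intro max) (auto simp: pairwise_insert)
    then show ?thesis
      by blast
  qed
  with E show thesis
    by (rule that)
qed

text \<open>A set that is maximal among the orthonormal subsets of \<open>W \<union> W\<^sup>\<bottom>\<close> is already maximal
in the whole space: if \<open>x\<close> is orthogonal to it then so is each of the components of \<open>x\<close> in \<open>W\<close>
and in the complement, as every basis vector sees only one of them.\<close>

lemma adapted_onb_exists:
  fixes W :: "'a::{real_inner,banach} set"
  assumes "subspace W" "closed W"
  obtains E where "real_onb E" "\<And>e. e \<in> E \<Longrightarrow> e \<in> W \<or> (\<forall>u\<in>W. inner u e = 0)"
proof -
  define D where "D = {x. x \<in> W \<or> (\<forall>u\<in>W. inner u x = 0)}"
  obtain E where E: "E \<subseteq> {x \<in> D. norm x = 1}" "pairwise orthogonal E"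
    and max: "\<And>x. x \<in> {x \<in> D. norm x = 1} \<Longrightarrow> (\<And>e. e \<in> E \<Longrightarrow> orthogonal e x) \<Longrightarrow> x \<in> E"
    by (rule maximal_pairwise_subset[where R = orthogonal and S = "{x \<in> D. norm x = 1}"])
      (simp add: orthogonal_commute, blast)
  have zero: "x = 0" if "x \<in> D" and orth: "\<And>e. e \<in> E \<Longrightarrow> inner e x = 0" for x
  proof (rule ccontr)
    assume "x \<noteq> 0"
    define y where "y = (1 / norm x) *\<^sub>R x"
    have "y \<in> D"
      using that(1) subspace_scale[OF assms(1)] by (auto simp: D_def y_def)
    then have "y \<in> E"
      using \<open>x \<noteq> 0\<close> orth by (intro max) (auto simp: y_def orthogonal_def)
    then show False
      using orth[of y] \<open>x \<noteq> 0\<close> by (simp add: y_def)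
  qed
  have "x = 0" if orth: "\<And>e. e \<in> E \<Longrightarrow> inner e x = 0" for x
  proof -
    obtain w where "w \<in> W" and w: "\<And>u. u \<in> W \<Longrightarrow> inner u (x - w) = 0"
      using orthogonal_projection_exists[OF assms] by blast
    have "inner e w = 0" if "e \<in> E" for e
      using that E(1) orth[OF that] w[of e] \<open>w \<in> W\<close>
      by (auto simp: D_def inner_diff_right inner_commute)
    then have "w = 0"
      using \<open>w \<in> W\<close> by (intro zero) (auto simp: D_def)
    then have "x \<in> D"
      using w by (simp add: D_def)
    then show "x = 0"
      using orth by (rule zero)
  qed
  then have "real_onb E"
    using E by (auto simp: real_onb_def orthonormal_def)
  then show thesis
    using E(1) by (intro that) (auto simp: D_def)
qed

section \<open>Absolute values of symmetric operators\<close>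

definition is_abs :: "('a::real_inner \<Rightarrow> 'a) \<Rightarrow> ('a \<Rightarrow> 'a) \<Rightarrow> bool" where
  "is_abs P Y \<longleftrightarrow> symmetric_op Y \<and> psd_op P \<and> P \<circ> P = Y \<circ> Y"

text \<open>The square root of \<open>Y \<circ> Y\<close> commutes with everything that commutes with \<open>Y \<circ> Y\<close>, and
\<open>Y\<close> does.\<close>

lemma is_abs_commute:
  fixes Y :: "'a::{real_inner,banach} \<Rightarrow> 'a"
  assumes "is_abs P Y"
  shows "P (Y x) = Y (P x)"
proof -
  have Y: "symmetric_op Y" and P: "psd_op P" "P \<circ> P = Y \<circ> Y"
    using assms by (simp_all add: is_abs_def)
  obtain S where S: "psd_op S" "S \<circ> S = Y \<circ> Y"
    "\<And>C. bounded_linear C \<Longrightarrow> C \<circ> (Y \<circ> Y) = (Y \<circ> Y) \<circ> C \<Longrightarrow> C \<circ> S = S \<circ> C"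
    using psd_op_sqrt_exists[OF psd_op_square[OF Y]] by blast
  have "P = S"
    using psd_op_sqrt_unique[OF P(1) S(1)] P(2) S(2) by simp
  moreover have "Y \<circ> S = S \<circ> Y"
    using Y by (intro S(3)) (simp_all add: comp_assoc symmetric_op_bounded_linear)
  ultimately show ?thesis
    by (metis comp_apply)
qed

lemma is_abs_agreement_subspace:
  assumes "is_abs P Y"
  shows "subspace {x. P x = Y x}" "closed {x. P x = Y x}"
proof -
  have bl: "bounded_linear P" "bounded_linear Y"
    using assms by (simp_all add: is_abs_def psd_op_symmetric symmetric_op_bounded_linear)
  then have "linear P" "linear Y"
    by (simp_all add: bounded_linear.linear)
  then show "subspace {x. P x = Y x}"
    by (auto simp: subspace_def linear_add linear_scale linear_0)
  show "closed {x. P x = Y x}"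
    by (intro closed_Collect_eq linear_continuous_on bl)
qed

text \<open>Since \<open>P\<close> and \<open>Y\<close> commute, \<open>(P - Y) (P + Y) = P\<^sup>2 - Y\<^sup>2 = 0\<close>, so \<open>P + Y\<close> maps into the
subspace where \<open>P\<close> and \<open>Y\<close> agree. By symmetry \<open>P + Y\<close> then vanishes on the orthogonal
complement of that subspace. So the space splits into a part with \<open>Y = P\<close> and one with
\<open>Y = - P\<close>, without any spectral theorem.\<close>

lemma is_abs_eq_neg_on_complement:
  fixes Y :: "'a::{real_inner,banach} \<Rightarrow> 'a"
  assumes "is_abs P Y" and orth: "\<And>u. P u = Y u \<Longrightarrow> inner u x = 0"
  shows "P x = - Y x"
proof -
  have sym: "symmetric_op P" "symmetric_op Y" and PP: "P (P y) = Y (Y y)" for y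
    using assms(1) by (auto simp: is_abs_def psd_op_symmetric fun_eq_iff)
  then have lin: "linear P" "linear Y"
    by (simp_all add: symmetric_op_linear)
  define z where "z = P x + Y x"
  have "P (P z + Y z) = Y (P z + Y z)"
    by (simp add: linear_add[OF lin(1)] linear_add[OF lin(2)] PP is_abs_commute[OF assms(1)])
  then have "inner (P z + Y z) x = 0"
    by (rule orth)
  then have "inner z z = 0"
    using symmetric_op_swap[OF sym(1), of z x] symmetric_op_swap[OF sym(2), of z x]
    by (simp add: z_def inner_add_left inner_add_right)
  then show ?thesis
    by (simp add: z_def eq_neg_iff_add_eq_0)
qed

text \<open>\<open>P - Y\<close> vanishes where \<open>P\<close> and \<open>Y\<close> agree and equals \<open>2 P\<close> on the orthogonal complement.\<close>

lemma is_abs_diff_psd: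
  fixes Y :: "'a::{real_inner,banach} \<Rightarrow> 'a"
  assumes "is_abs P Y"
  shows "psd_op (\<lambda>x. P x - Y x)"
proof -
  define A where "A = (\<lambda>x. P x - Y x)"
  have P: "psd_op P" and Y: "symmetric_op Y"
    using assms by (simp_all add: is_abs_def)
  then have A: "symmetric_op A"
    using symmetric_op_diff[OF psd_op_symmetric Y] by (simp add: A_def)
  have "0 \<le> inner x (A x)" for x
  proof -
    obtain w where Aw: "P w = Y w" and v: "\<And>u. P u = Y u \<Longrightarrow> inner u (x - w) = 0"
      using orthogonal_projection_exists[OF is_abs_agreement_subspace[OF assms], of x] by auto
    define v where "v = x - w"
    have "A v = A x"
      using Aw linear_diff[OF symmetric_op_linear[OF A], of x w] by (simp add: v_def A_def)
    then have "inner x (A x) = inner (A v) v"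
      using symmetric_op_swap[OF A, of x v] symmetric_op_swap[OF A, of v v] by simp
    also have "A v = 2 *\<^sub>R P v"
      using is_abs_eq_neg_on_complement[OF assms v] by (simp add: A_def v_def scaleR_2)
    finally show ?thesis
      using psd_op_nonneg[OF P, of v] by (simp add: inner_commute)
  qed
  then show ?thesis
    using A by (simp add: psd_op_def A_def)
qed

text \<open>\<open>P\<close> is also an absolute value of \<open>- Y\<close>.\<close>

lemma is_abs_add_psd:
  fixes Y :: "'a::{real_inner,banach} \<Rightarrow> 'a"
  assumes "is_abs P Y"
  shows "psd_op (\<lambda>x. P x + Y x)"
proof -
  have "linear Y"
    using assms by (simp add: is_abs_def symmetric_op_linear)
  then have "is_abs P (\<lambda>x. - Y x)"
    using assms symmetric_op_scaleR[of Y "-1"]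
    by (simp add: is_abs_def comp_def fun_eq_iff linear_neg)
  then show ?thesis
    using is_abs_diff_psd by fastforce
qed

lemma is_abs_bound:
  fixes Y :: "'a::{real_inner,banach} \<Rightarrow> 'a"
  assumes "is_abs P Y"
  shows "\<bar>inner x (Y x)\<bar> \<le> inner x (P x)"
  using psd_op_nonneg[OF is_abs_diff_psd[OF assms], of x]
    psd_op_nonneg[OF is_abs_add_psd[OF assms], of x]
  by (simp add: inner_diff_right inner_add_right abs_le_iff)

section \<open>The trace of a positive semidefinite operator\<close>

text \<open>With \<open>Q\<close> the square root of \<open>T\<close>, the diagonal entry of \<open>T\<close> at \<open>e\<close> is \<open>(norm (Q e))\<^sup>2\<close>, by
Parseval the sum over \<open>f\<close> of \<open>(inner f (Q e))\<^sup>2\<close>. This is symmetric in \<open>e\<close> and \<open>f\<close>, and the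
double series has nonnegative terms, so the order of summation can be exchanged.\<close>

lemma psd_trace_basis_independent:
  fixes T :: "'a::{real_inner,banach} \<Rightarrow> 'a"
  assumes "psd_op T" "real_onb E" "real_onb F"
    and s: "((\<lambda>e. inner e (T e)) has_sum s) E"
  shows "((\<lambda>f. inner f (T f)) has_sum s) F"
proof -
  obtain Q where Q: "psd_op Q" "Q \<circ> Q = T"
    using psd_op_sqrt_exists[OF assms(1)] by blast
  have swap: "inner (Q x) y = inner x (Q y)" for x y
    using Q(1) by (simp add: psd_op_symmetric symmetric_op_swap)
  have T: "inner x (T x) = (norm (Q x))\<^sup>2" for x
    using swap[of x "Q x"] Q(2) by (auto simp: power2_norm_eq_inner)
  define g where "g = (\<lambda>(e, f). (inner f (Q e))\<^sup>2)"
  have rows: "((\<lambda>f. g (e, f)) has_sum (norm (Q e))\<^sup>2) F" for e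
    using parseval[OF assms(3)] by (simp add: g_def)
  have sumE: "((\<lambda>e. (norm (Q e))\<^sup>2) has_sum s) E"
    using s by (simp add: T)
  have "g summable_on E \<times> F"
    using rows has_sum_imp_summable[OF sumE] by (rule summable_on_SigmaI) (auto simp: g_def)
  with rows sumE have "(g has_sum s) (E \<times> F)"
    by (rule has_sum_SigmaI)
  then have "((\<lambda>(f, e). g (e, f)) has_sum s) (F \<times> E)"
    by (subst (asm) has_sum_swap)
  moreover have "((\<lambda>e. (case (f, e) of (f, e) \<Rightarrow> g (e, f))) has_sum (norm (Q f))\<^sup>2) E" for f
  proof -
    have "inner f (Q e) = inner e (Q f)" for e
      using swap[of f e] by (metis inner_commute)
    then have "g (e, f) = (inner e (Q f))\<^sup>2" for e
      by (simp add: g_def)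
    then show ?thesis
      using parseval[OF assms(2)] by simp
  qed
  ultimately show ?thesis
    unfolding T by (rule has_sum_SigmaD)
qed

text \<open>Each vector of a basis adapted to the subspace where \<open>P\<close> agrees with \<open>A - B\<close> satisfies
\<open>P g = (A - B) g\<close> or \<open>P g = - (A - B) g\<close>. In either case the diagonal entry of \<open>P\<close> is at most
the sum of those of \<open>A\<close> and \<open>B\<close>. Basis independence of the three traces transfers the
inequality to the given basis.\<close>

lemma trace_abs_diff_le:
  fixes A B :: "'a::{real_inner,banach} \<Rightarrow> 'a"
  assumes abs: "is_abs P (\<lambda>x. A x - B x)" and psd: "psd_op A" "psd_op B" and E: "real_onb E"
    and a: "((\<lambda>e. inner e (A e)) has_sum a) E"
    and b: "((\<lambda>e. inner e (B e)) has_sum b) E"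
    and p: "((\<lambda>e. inner e (P e)) has_sum p) E"
  shows "p \<le> a + b"
proof -
  obtain G where G: "real_onb G"
    and G_cases: "\<And>g. g \<in> G \<Longrightarrow> P g = A g - B g \<or> (\<forall>u. P u = A u - B u \<longrightarrow> inner u g = 0)"
    by (rule adapted_onb_exists[OF is_abs_agreement_subspace[OF abs]]) blast
  have "psd_op P"
    using abs by (simp add: is_abs_def)
  then have "((\<lambda>g. inner g (P g)) has_sum p) G"
    using E G p by (rule psd_trace_basis_independent)
  moreover have "((\<lambda>g. inner g (A g) + inner g (B g)) has_sum a + b) G"
    by (intro has_sum_add psd_trace_basis_independent[OF psd(1) E G a]
        psd_trace_basis_independent[OF psd(2) E G b])
  ultimately show ?thesis
  proof (rule has_sum_mono)
    fix g assume "g \<in> G"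
    have "P g = A g - B g \<or> P g = - (A g - B g)"
      using G_cases[OF \<open>g \<in> G\<close>] is_abs_eq_neg_on_complement[OF abs, of g] by blast
    then show "inner g (P g) \<le> inner g (A g) + inner g (B g)"
      using psd_op_nonneg[OF psd(1), of g] psd_op_nonneg[OF psd(2), of g]
      by (auto simp: inner_diff_right)
  qed
qed

text \<open>\<open>P - Y\<close> is positive semidefinite with trace at most \<open>0\<close>, so its diagonal entries vanish and
it annihilates every basis vector. Being symmetric, it maps into the orthogonal complement of the
basis, that is, to \<open>0\<close>.\<close>

lemma is_abs_eq_if_trace_le:
  fixes Y :: "'a::{real_inner,banach} \<Rightarrow> 'a"
  assumes abs: "is_abs P Y" and E: "real_onb E"
    and p: "((\<lambda>e. inner e (P e)) has_sum p) E"
    and y: "((\<lambda>e. inner e (Y e)) has_sum y) E"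
    and "p \<le> y"
  shows "P = Y"
proof
  fix x
  define A where "A = (\<lambda>x. P x - Y x)"
  have A: "psd_op A"
    unfolding A_def using abs by (rule is_abs_diff_psd)
  have "((\<lambda>e. inner e (A e)) has_sum p - y) E"
    using has_sum_add[OF p, of "\<lambda>e. - inner e (Y e)" "- y"] y
    by (simp add: A_def inner_diff_right has_sum_uminus)
  then have diag: "inner e (A e) = 0" if "e \<in> E" for e
    by (rule nonneg_has_sum_le_0D) (use \<open>p \<le> y\<close> psd_op_nonneg[OF A] that in auto)
  have "A x = 0"
    using E
  proof (rule real_onb_eq_0)
    fix e assume "e \<in> E"
    then have "A e = 0"
      using diag psd_op_eq_0[OF A] by blast
    then show "inner e (A x) = 0"
      using symmetric_op_swap[OF psd_op_symmetric[OF A], of e x] by simp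
  qed
  then show "P x = Y x"
    by (simp add: A_def)
qed

section \<open>Complex Hilbert spaces\<close>

instance chilbert_space \<subseteq> banach ..

lemma cinner_scaleC_left: "cinner (a *\<^sub>C x) y = cnj a * cinner x y"
  by (subst cinner_commute) (simp add: cinner_scaleC_right cinner_commute[of y x])

lemma Im_cinner: "Im (cinner x y) = - inner x (\<i> *\<^sub>C y)"
  by (simp add: cinner_scaleC_right flip: Re_cinner)

lemma inner_ii: "inner (\<i> *\<^sub>C x) (\<i> *\<^sub>C y) = inner x (y :: 'h::complex_inner)"
  by (simp add: cinner_scaleC_left cinner_scaleC_right flip: Re_cinner)

lemma inner_i_left: "inner (\<i> *\<^sub>C x) y = - inner x (\<i> *\<^sub>C y :: 'h::complex_inner)"
  by (simp add: cinner_scaleC_left cinner_scaleC_right flip: Re_cinner)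

lemma norm_scaleC: "norm (c *\<^sub>C x) = cmod c * norm (x :: 'h::complex_inner)"
proof -
  have "Im (cinner x x) = 0"
    using arg_cong[OF cinner_commute[of x x], of Im] by simp
  moreover have "(cmod c)\<^sup>2 = Re c * Re c + Im c * Im c"
    using cmod_power2[of c] by (simp only: power2_eq_square)
  ultimately have "inner (c *\<^sub>C x) (c *\<^sub>C x) = (cmod c)\<^sup>2 * inner x x"
    by (simp add: cinner_scaleC_left cinner_scaleC_right algebra_simps flip: Re_cinner)
  then show ?thesis
    by (simp add: norm_eq_sqrt_inner real_sqrt_mult)
qed

lemma bounded_linear_scaleC: "bounded_linear (\<lambda>x :: 'h::complex_inner. c *\<^sub>C x)"
proof (rule bounded_linear_intro[of _ "cmod c"])
  show "c *\<^sub>C (r *\<^sub>R x) = r *\<^sub>R (c *\<^sub>C x)" for r and x :: 'h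
    by (simp add: scaleC_scaleC mult.commute flip: scaleC_of_real)
qed (simp_all add: scaleC_add_right norm_scaleC mult.commute)

lemma cinner_self: "cinner x x = of_real ((norm x)\<^sup>2)"
  using arg_cong[OF cinner_commute[of x x], of Im]
  by (simp add: complex_eq_iff Re_cinner power2_norm_eq_inner)

lemma hermitian_iff_symmetric: "hermitian T \<longleftrightarrow> bounded_clinear T \<and> symmetric_op T"
proof (intro iffI conjI)
  assume "hermitian T"
  then show "bounded_clinear T" "symmetric_op T"
    by (auto simp: hermitian_def is_adjoint_def bounded_clinear_def symmetric_op_def
        simp flip: Re_cinner)
next
  assume T: "bounded_clinear T \<and> symmetric_op T"
  then have "cinner (T x) y = cinner x (T y)" for x y
    using symmetric_op_swap[of T x y] symmetric_op_swap[of T x "\<i> *\<^sub>C y"]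
    by (simp add: complex_eq_iff Re_cinner Im_cinner bounded_clinear_def)
  with T show "hermitian T"
    by (simp add: hermitian_def is_adjoint_def)
qed

text \<open>Over the complex numbers a real quadratic form forces symmetry: polarise the vanishing of
\<open>Im (cinner z (T z))\<close>, that is of \<open>inner z (\<i> *\<^sub>C T z)\<close>, at \<open>z = x + \<i> *\<^sub>C y\<close>.\<close>

lemma positive_op_iff_psd: "positive_op T \<longleftrightarrow> bounded_clinear T \<and> psd_op T"
proof (intro iffI conjI)
  assume pos: "positive_op T"
  then show cl: "bounded_clinear T"
    by (simp add: positive_op_def)
  then have lin: "linear T" and scale: "\<And>c x. T (c *\<^sub>C x) = c *\<^sub>C T x"
    by (simp_all add: bounded_clinear_def bounded_linear.linear)
  have nonneg: "0 \<le> inner z (T z)" and im: "inner z (\<i> *\<^sub>C T z) = 0" for z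
    using pos Im_cinner[of z "T z"]
    by (simp_all add: positive_op_def complex_nonneg_Reals_iff Re_cinner)
  have "inner y (T x) = inner x (T y)" for x y
  proof -
    have "0 = inner (x + \<i> *\<^sub>C y) (\<i> *\<^sub>C T (x + \<i> *\<^sub>C y))"
      using im by simp
    also have "\<dots> = inner x (\<i> *\<^sub>C T x) + inner x (\<i> *\<^sub>C \<i> *\<^sub>C T y) + inner y (T x)
        + inner y (\<i> *\<^sub>C T y)"
      by (simp add: linear_add[OF lin] scale scaleC_add_right inner_add_left inner_add_right
          inner_ii)
    also have "\<i> *\<^sub>C \<i> *\<^sub>C T y = - T y"
      using scaleC_of_real[of "-1" "T y"] by (simp add: scaleC_scaleC)
    finally show ?thesis
      by (simp add: im)
  qed
  then show "psd_op T"
    using cl nonneg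
    by (simp add: psd_op_def symmetric_op_def bounded_clinear_def inner_commute)
next
  assume T: "bounded_clinear T \<and> psd_op T"
  then have "inner x (\<i> *\<^sub>C T x) = inner (T x) (\<i> *\<^sub>C x)" for x
    using symmetric_op_swap[OF psd_op_symmetric, of T x "\<i> *\<^sub>C x"]
    by (simp add: bounded_clinear_def)
  then have "inner x (\<i> *\<^sub>C T x) = 0" for x
    using inner_i_left[of "x" "T x"] by (simp add: inner_commute)
  then show "positive_op T"
    using T by (simp add: positive_op_def complex_nonneg_Reals_iff Re_cinner Im_cinner psd_op_def)
qed

lemma positive_op_hermitian: "positive_op T \<Longrightarrow> hermitian T"
  by (simp add: positive_op_iff_psd hermitian_iff_symmetric psd_op_symmetric)

lemma cadjoint_hermitian:
  assumes "hermitian T"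
  shows "cadjoint T = T"
  unfolding cadjoint_def
proof (rule the_equality)
  show "is_adjoint T T"
    using assms by (simp add: hermitian_def)
  fix S assume "is_adjoint S T"
  then have "inner (S x) y = inner (T x) y" for x y
    using \<open>is_adjoint T T\<close> by (simp add: is_adjoint_def flip: Re_cinner)
  then show "S = T"
    by (metis ext vector_eq_rdot)
qed

lemma sqrt_op_eqI:
  fixes P :: "'h::chilbert_space \<Rightarrow> 'h"
  assumes "positive_op P" "P \<circ> P = T"
  shows "sqrt_op T = P"
  unfolding sqrt_op_def
proof (rule the_equality)
  show "Q = P" if "positive_op Q \<and> Q \<circ> Q = T" for Q
    by (rule psd_op_sqrt_unique) (use that assms in \<open>simp_all add: positive_op_iff_psd\<close>)
qed (use assms in simp)

lemma abs_op_positive: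
  fixes T :: "'h::chilbert_space \<Rightarrow> 'h"
  assumes "positive_op T"
  shows "abs_op T = T"
  unfolding abs_op_def cadjoint_hermitian[OF positive_op_hermitian[OF assms]]
  using assms by (intro sqrt_op_eqI) simp_all

text \<open>The real square root of \<open>X \<circ> X\<close> is complex linear because it commutes with each scalar
multiplication, a bounded real linear map that commutes with \<open>X \<circ> X\<close>.\<close>

lemma abs_op_hermitian:
  fixes X :: "'h::chilbert_space \<Rightarrow> 'h"
  assumes "hermitian X"
  shows "positive_op (abs_op X)" "is_abs (abs_op X) X"
proof -
  have X: "symmetric_op X" and scale: "\<And>c x. X (c *\<^sub>C x) = c *\<^sub>C X x"
    using assms by (simp_all add: hermitian_iff_symmetric bounded_clinear_def)
  obtain S where S: "psd_op S" "S \<circ> S = X \<circ> X"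
    and comm: "\<And>C. bounded_linear C \<Longrightarrow> C \<circ> (X \<circ> X) = (X \<circ> X) \<circ> C \<Longrightarrow> C \<circ> S = S \<circ> C"
    using psd_op_sqrt_exists[OF psd_op_square[OF X]] by blast
  have "(\<lambda>x. c *\<^sub>C x) \<circ> S = S \<circ> (\<lambda>x. c *\<^sub>C x)" for c
    by (intro comm bounded_linear_scaleC) (simp add: comp_def scale)
  then have "S (c *\<^sub>C x) = c *\<^sub>C S x" for c x
    by (metis comp_apply)
  then have pos: "positive_op S"
    using S(1) by (simp add: positive_op_iff_psd bounded_clinear_def psd_op_def symmetric_op_def)
  then have "abs_op X = S"
    unfolding abs_op_def cadjoint_hermitian[OF assms] using S(2) by (rule sqrt_op_eqI)
  then show "positive_op (abs_op X)" "is_abs (abs_op X) X"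
    using pos S X by (simp_all add: is_abs_def)
qed

lemma is_onb_some_onb: "is_onb (some_onb :: 'h::complex_inner set)"
  unfolding some_onb_def
proof (rule someI_ex)
  obtain E :: "'h set" where E: "E \<subseteq> {x. norm x = 1}" "pairwise (\<lambda>x y. cinner x y = 0) E"
    and max: "\<And>x. x \<in> {x. norm x = 1} \<Longrightarrow> (\<And>e. e \<in> E \<Longrightarrow> cinner e x = 0) \<Longrightarrow> x \<in> E"
  proof (rule maximal_pairwise_subset[where R = "\<lambda>x y :: 'h. cinner x y = 0"
        and S = "{x. norm x = 1}"])
    show "cinner y x = 0" if "cinner x y = 0" for x y :: 'h
      using that cinner_commute[of y x] by simp
  qed blast
  have "x = 0" if orth: "\<forall>e\<in>E. cinner e x = 0" for x
  proof (rule ccontr)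
    assume "x \<noteq> 0"
    define y where "y = of_real (1 / norm x) *\<^sub>C x"
    have "y \<in> E"
      using orth \<open>x \<noteq> 0\<close> by (intro max) (auto simp: y_def norm_scaleC cinner_scaleC_right norm_divide)
    then have "cinner y x = 0"
      using orth by blast
    then show False
      using \<open>x \<noteq> 0\<close> by (simp add: y_def cinner_scaleC_left cinner_self)
  qed
  moreover have "cinner e f = (if e = f then 1 else 0)" if "e \<in> E" "f \<in> E" for e f
    using E that by (auto simp: cinner_self pairwise_def)
  ultimately show "\<exists>E :: 'h set. is_onb E"
    unfolding is_onb_def by (intro exI[of _ E] conjI ballI allI impI)
qed

text \<open>A complex orthonormal basis together with its multiples by \<open>\<i>\<close> is a real orthonormal basis
of the underlying real space. In it every diagonal entry of a complex linear operator occurs twice,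
so real traces are twice the complex ones.\<close>

definition realified :: "'h::complex_inner set \<Rightarrow> 'h set" where
  "realified E = E \<union> (\<lambda>e. \<i> *\<^sub>C e) ` E"

lemma real_onb_realified:
  assumes "is_onb E"
  shows "real_onb (realified E)"
proof -
  have on: "cinner e f = (if e = f then 1 else 0)" if "e \<in> E" "f \<in> E" for e f
    using assms that by (simp add: is_onb_def)
  have inner: "inner e f = (if e = f then 1 else 0)" "inner e (\<i> *\<^sub>C f) = 0"
    "inner (\<i> *\<^sub>C e) f = 0" if "e \<in> E" "f \<in> E" for e f
    using on[OF that] Re_cinner[of e f] Im_cinner[of e f] inner_i_left[of e f]
    by (auto split: if_splits)
  have "pairwise orthogonal (realified E)"
    unfolding pairwise_def realified_def orthogonal_def
    using inner by (auto simp: inner_ii)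
  moreover have "norm e = 1" if "e \<in> E" for e
    using inner(1)[OF that that] by (simp add: norm_eq_sqrt_inner)
  then have "norm e = 1" if "e \<in> realified E" for e
    using that by (auto simp: realified_def norm_scaleC)
  moreover have "x = 0" if "\<forall>e\<in>realified E. inner e x = 0" for x
  proof -
    have "cinner e x = 0" if "e \<in> E" for e
    proof (rule complex_eqI)
      show "Re (cinner e x) = Re 0"
        using \<open>\<forall>e\<in>realified E. inner e x = 0\<close> that by (simp add: Re_cinner realified_def)
      have "inner (\<i> *\<^sub>C e) x = 0"
        using \<open>\<forall>e\<in>realified E. inner e x = 0\<close> that by (auto simp: realified_def)
      then show "Im (cinner e x) = Im 0"
        by (simp add: Im_cinner inner_i_left)
    qed
    then show ?thesis
      using assms by (simp add: is_onb_def)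
  qed
  ultimately show ?thesis
    by (simp add: real_onb_def orthonormal_def)
qed

lemma has_sum_realified:
  assumes "is_onb E" "bounded_clinear T"
    and s: "((\<lambda>e. inner e (T e)) has_sum s) E"
  shows "((\<lambda>e. inner e (T e)) has_sum (s + s)) (realified E)"
  unfolding realified_def
proof (rule has_sum_Un_disjoint[OF s])
  have inj: "inj_on (\<lambda>e. \<i> *\<^sub>C e) E"
  proof (rule inj_onI)
    fix e f assume "\<i> *\<^sub>C e = \<i> *\<^sub>C f"
    then have "(-\<i>) *\<^sub>C \<i> *\<^sub>C e = (-\<i>) *\<^sub>C \<i> *\<^sub>C f"
      by simp
    then show "e = f"
      using scaleC_of_real[of 1 e] scaleC_of_real[of 1 f] by (simp add: scaleC_scaleC)
  qed
  have "((\<lambda>e. inner (\<i> *\<^sub>C e) (T (\<i> *\<^sub>C e))) has_sum s) E"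
    using s assms(2) by (simp add: bounded_clinear_def inner_ii)
  then show "((\<lambda>e. inner e (T e)) has_sum s) ((\<lambda>e. \<i> *\<^sub>C e) ` E)"
    by (subst has_sum_reindex[OF inj]) (simp add: comp_def)
  have "\<i> *\<^sub>C f \<notin> E" if "f \<in> E" for f
  proof
    assume "\<i> *\<^sub>C f \<in> E"
    then have "cinner f (\<i> *\<^sub>C f) \<in> {0, 1}"
      using assms(1) that by (simp add: is_onb_def)
    then show False
      using assms(1) that by (simp add: is_onb_def cinner_scaleC_right complex_eq_iff)
  qed
  then show "E \<inter> (\<lambda>e. \<i> *\<^sub>C e) ` E = {}"
    by blast
qed

lemma cinner_hermitian:
  assumes "hermitian X"
  shows "cinner x (X x) = of_real (inner x (X x))"
proof -
  have "cinner x (X x) = cnj (cinner x (X x))"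
    using assms cinner_commute[of x "X x"] by (simp add: hermitian_def is_adjoint_def)
  then show ?thesis
    by (simp add: complex_eq_iff Re_cinner)
qed

lemma trace_class_hermitian_iff:
  fixes X :: "'h::chilbert_space \<Rightarrow> 'h"
  assumes "hermitian X"
  shows "X \<in> trace_class \<longleftrightarrow> (\<lambda>e. inner e (abs_op X e)) summable_on some_onb"
proof -
  have "(\<lambda>e. cinner e (abs_op X e)) = (\<lambda>e. complex_of_real (inner e (abs_op X e)))"
    using cinner_hermitian[OF positive_op_hermitian[OF abs_op_hermitian(1)[OF assms]]] by blast
  moreover have "bounded_clinear X"
    using assms by (simp add: hermitian_def)
  ultimately show ?thesis
    by (auto simp: trace_class_def intro: summable_on_of_real dest: summable_on_Re)
qed

lemma has_sum_op_trace:
  assumes "hermitian X" and sum: "(\<lambda>e. inner e (X e)) summable_on some_onb"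
  shows "((\<lambda>e. inner e (X e)) has_sum Re (op_trace X)) some_onb"
proof -
  obtain s where s: "((\<lambda>e. inner e (X e)) has_sum s) some_onb"
    using sum by (auto simp: summable_on_def)
  then have "op_trace X = of_real s"
    unfolding op_trace_def cinner_hermitian[OF assms(1)] by (intro infsumI has_sum_of_real)
  with s show ?thesis
    by simp
qed

lemma has_sum_trace_norm:
  fixes X :: "'h::chilbert_space \<Rightarrow> 'h"
  assumes "hermitian X" "X \<in> trace_class"
  shows "((\<lambda>e. inner e (abs_op X e)) has_sum trace_norm X) some_onb"
  unfolding trace_norm_def
  by (rule has_sum_op_trace[OF positive_op_hermitian[OF abs_op_hermitian(1)[OF assms(1)]]])
    (use assms in \<open>simp add: trace_class_hermitian_iff\<close>)

text \<open>The diagonal of \<open>X\<close> is dominated by that of \<open>abs_op X\<close>.\<close>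

lemma has_sum_trace:
  fixes X :: "'h::chilbert_space \<Rightarrow> 'h"
  assumes "hermitian X" "X \<in> trace_class"
  shows "((\<lambda>e. inner e (X e)) has_sum Re (op_trace X)) some_onb"
proof (rule has_sum_op_trace[OF assms(1)])
  have "(\<lambda>e. inner e (abs_op X e)) summable_on some_onb"
    using assms by (simp add: trace_class_hermitian_iff)
  then have "(\<lambda>e. norm (inner e (X e))) summable_on some_onb"
    by (rule summable_on_comparison_test) (simp_all add: is_abs_bound[OF abs_op_hermitian(2)[OF assms(1)]])
  then show "(\<lambda>e. inner e (X e)) summable_on some_onb"
    by (rule abs_summable_summable)
qed

lemma positive_trace_class_if_dominated:
  fixes T :: "'h::chilbert_space \<Rightarrow> 'h"
  assumes "positive_op T" "hermitian X" "X \<in> trace_class"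
    and le: "\<And>x. inner x (T x) \<le> inner x (abs_op X x)"
  shows "T \<in> trace_class"
proof -
  have "(\<lambda>e. inner e (abs_op X e)) summable_on some_onb"
    using assms by (simp add: trace_class_hermitian_iff)
  then have "(\<lambda>e. inner e (T e)) summable_on some_onb"
    by (rule summable_on_comparison_test)
      (use le assms(1) in \<open>auto simp: positive_op_iff_psd psd_op_nonneg\<close>)
  then show ?thesis
    using assms(1) by (simp add: trace_class_hermitian_iff positive_op_hermitian abs_op_positive)
qed

section \<open>Positivity and the trace norm\<close>

text \<open>The positive part \<open>A\<close> and the negative part \<open>B\<close> of \<open>X\<close> are half the sum and half the
difference of \<open>abs_op X\<close> and \<open>X\<close>. The relation between them is stated as a sum, so that additivity
of a map on the trace class operators applies to it directly.\<close>

lemma jordan_decomposition: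
  fixes X :: "'h::chilbert_space \<Rightarrow> 'h"
  assumes "hermitian X" "X \<in> trace_class"
  obtains A B where "positive_op A" "A \<in> trace_class" "positive_op B" "B \<in> trace_class"
    "A = (\<lambda>v. X v + B v)" "trace_norm X = Re (op_trace A) + Re (op_trace B)"
proof -
  define P where "P = abs_op X"
  have abs: "is_abs P X" and "positive_op P"
    unfolding P_def by (fact abs_op_hermitian[OF assms(1)])+
  define A where "A = (\<lambda>v. (1/2) *\<^sub>R (P v + X v))"
  define B where "B = (\<lambda>v. (1/2) *\<^sub>R (P v - X v))"
  have half: "psd_op (\<lambda>v. (1/2) *\<^sub>R T v)" if "psd_op T" for T :: "'h \<Rightarrow> 'h"
    using that by (simp add: psd_op_def symmetric_op_scaleR)
  have psd: "psd_op A" "psd_op B"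
    unfolding A_def B_def by (intro half is_abs_add_psd is_abs_diff_psd abs)+
  \<comment> \<open>Only complex linearity has to be added to the real facts.\<close>
  have scale: "P (c *\<^sub>C v) = c *\<^sub>C P v" "X (c *\<^sub>C v) = c *\<^sub>C X v" for c v
    using assms(1) \<open>positive_op P\<close>
    by (simp_all add: hermitian_def positive_op_def bounded_clinear_def)
  have lin: "linear (\<lambda>v :: 'h. c *\<^sub>C v)" for c
    using bounded_linear_scaleC by (rule bounded_linear.linear)
  have "A (c *\<^sub>C v) = c *\<^sub>C A v" "B (c *\<^sub>C v) = c *\<^sub>C B v" for c v
    using linear_add[OF lin[of c]] linear_diff[OF lin[of c]] linear_scale[OF lin[of c]]
    by (simp_all add: A_def B_def scale)
  then have pos: "positive_op A" "positive_op B"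
    using psd by (simp_all add: positive_op_iff_psd bounded_clinear_def psd_op_def symmetric_op_def)
  have "inner x (A x) \<le> inner x (abs_op X x)" "inner x (B x) \<le> inner x (abs_op X x)" for x
    using is_abs_bound[OF abs, of x]
    by (auto simp: A_def B_def P_def[symmetric] inner_add_right inner_diff_right abs_le_iff)
  then have tc: "A \<in> trace_class" "B \<in> trace_class"
    using positive_trace_class_if_dominated[OF _ assms] pos by blast+
  have X: "A = (\<lambda>v. X v + B v)"
  proof
    fix v
    have "A v - B v = (1/2) *\<^sub>R ((P v + X v) - (P v - X v))"
      by (simp only: A_def B_def scaleR_diff_right)
    also have "(P v + X v) - (P v - X v) = 2 *\<^sub>R X v"
      by (simp add: scaleR_2)
    finally show "A v = X v + B v"
      by (simp add: diff_eq_eq)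
  qed
  have "((\<lambda>e. inner e (A e) + inner e (B e)) has_sum (Re (op_trace A) + Re (op_trace B))) some_onb"
    using pos tc by (intro has_sum_add has_sum_trace positive_op_hermitian)
  moreover have "inner e (A e) + inner e (B e) = inner e (abs_op X e)" for e
    by (simp add: A_def B_def P_def[symmetric] inner_add_right inner_diff_right field_simps)
  ultimately have "trace_norm X = Re (op_trace A) + Re (op_trace B)"
    using has_sum_unique[OF has_sum_trace_norm[OF assms]] by simp
  then show thesis
    by (rule that[OF pos(1) tc(1) pos(2) tc(2) X])
qed

text \<open>The complex form of \<open>trace_abs_diff_le\<close>; both sides are doubled in the realified basis.\<close>

lemma trace_norm_le_if_diff_positive:
  fixes Y :: "'h::chilbert_space \<Rightarrow> 'h"
  assumes Y: "hermitian Y" "Y \<in> trace_class"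
    and A: "positive_op A" "A \<in> trace_class" and B: "positive_op B" "B \<in> trace_class"
    and eq: "A = (\<lambda>v. Y v + B v)"
  shows "trace_norm Y \<le> Re (op_trace A) + Re (op_trace B)"
proof -
  have "(\<lambda>v. A v - B v) = Y"
    by (simp add: eq)
  then have abs: "is_abs (abs_op Y) (\<lambda>v. A v - B v)"
    using abs_op_hermitian(2)[OF Y(1)] by simp
  have cl: "bounded_clinear A" "bounded_clinear B" "bounded_clinear (abs_op Y)"
    using A B abs_op_hermitian(1)[OF Y(1)] by (simp_all add: positive_op_def)
  note double = has_sum_realified[OF is_onb_some_onb]
  have "trace_norm Y + trace_norm Y
      \<le> (Re (op_trace A) + Re (op_trace A)) + (Re (op_trace B) + Re (op_trace B))"
    using abs
  proof (rule trace_abs_diff_le)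
    show "psd_op A" "psd_op B"
      using A B by (simp_all add: positive_op_iff_psd)
    show "real_onb (realified some_onb :: 'h set)"
      by (intro real_onb_realified is_onb_some_onb)
    show "((\<lambda>e. inner e (A e)) has_sum Re (op_trace A) + Re (op_trace A)) (realified some_onb)"
      by (rule double[OF cl(1) has_sum_trace[OF positive_op_hermitian[OF A(1)] A(2)]])
    show "((\<lambda>e. inner e (B e)) has_sum Re (op_trace B) + Re (op_trace B)) (realified some_onb)"
      by (rule double[OF cl(2) has_sum_trace[OF positive_op_hermitian[OF B(1)] B(2)]])
    show "((\<lambda>e. inner e (abs_op Y e)) has_sum trace_norm Y + trace_norm Y) (realified some_onb)"
      by (rule double[OF cl(3) has_sum_trace_norm[OF Y]])
  qed
  then show ?thesis
    by simp
qed

lemma trace_norm_positive: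
  fixes T :: "'h::chilbert_space \<Rightarrow> 'h"
  assumes "positive_op T"
  shows "trace_norm T = Re (op_trace T)"
  unfolding trace_norm_def abs_op_positive[OF assms] ..

text \<open>The complex form of \<open>is_abs_eq_if_trace_le\<close>: if the trace reaches the trace norm then
\<open>Y\<close> coincides with its absolute value.\<close>

lemma positive_if_trace_norm_le_trace:
  fixes Y :: "'h::chilbert_space \<Rightarrow> 'h"
  assumes Y: "hermitian Y" "Y \<in> trace_class" and le: "trace_norm Y \<le> Re (op_trace Y)"
  shows "positive_op Y"
proof -
  have pos: "positive_op (abs_op Y)"
    by (rule abs_op_hermitian(1)[OF Y(1)])
  have cl: "bounded_clinear Y" "bounded_clinear (abs_op Y)"
    using Y pos by (simp_all add: positive_op_def hermitian_def)
  note double = has_sum_realified[OF is_onb_some_onb]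
  have "abs_op Y = Y"
  proof (rule is_abs_eq_if_trace_le[OF abs_op_hermitian(2)[OF Y(1)]
        real_onb_realified[OF is_onb_some_onb]])
    show "((\<lambda>e. inner e (abs_op Y e)) has_sum trace_norm Y + trace_norm Y) (realified some_onb)"
      by (rule double[OF cl(2) has_sum_trace_norm[OF Y]])
    show "((\<lambda>e. inner e (Y e)) has_sum Re (op_trace Y) + Re (op_trace Y)) (realified some_onb)"
      by (rule double[OF cl(1) has_sum_trace[OF Y]])
    show "trace_norm Y + trace_norm Y \<le> Re (op_trace Y) + Re (op_trace Y)"
      using le by simp
  qed
  with pos show ?thesis
    by simp
qed

theorem theorem2p1:
  fixes \<Phi> :: "('h::chilbert_space \<Rightarrow> 'h) \<Rightarrow> ('h \<Rightarrow> 'h)"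
  assumes "separable_space (euclidean :: 'h topology)"
    and "linear_on_trace_class \<Phi>"
    and "hermiticity_preserving \<Phi>"
    and "trace_preserving \<Phi>"
  shows "positive_map \<Phi> \<longleftrightarrow>
    (\<forall>X\<in>trace_class. hermitian X \<longrightarrow> trace_norm (\<Phi> X) \<le> trace_norm X)"
proof -
  note lin = assms(2)[unfolded linear_on_trace_class_def]
  have tc: "\<Phi> X \<in> trace_class" if "X \<in> trace_class" for X
    by (rule lin[THEN conjunct1, rule_format, OF that])
  have add: "\<Phi> (\<lambda>v. X v + Y v) = (\<lambda>v. \<Phi> X v + \<Phi> Y v)"
    if "X \<in> trace_class" "Y \<in> trace_class" for X Y
    by (rule lin[THEN conjunct2, THEN conjunct1, rule_format, OF that])
  have herm: "hermitian (\<Phi> X)" if "X \<in> trace_class" "hermitian X" for X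
    using assms(3) that by (simp add: hermiticity_preserving_def)
  have trace: "op_trace (\<Phi> X) = op_trace X" if "X \<in> trace_class" for X
    using assms(4) that by (simp add: trace_preserving_def)
  show ?thesis
  proof (intro iffI ballI impI)
    fix X :: "'h \<Rightarrow> 'h"
    assume pos: "positive_map \<Phi>" and X: "X \<in> trace_class" "hermitian X"
    obtain A B where A: "positive_op A" "A \<in> trace_class" and B: "positive_op B" "B \<in> trace_class"
      and X_eq: "A = (\<lambda>v. X v + B v)"
      and norm: "trace_norm X = Re (op_trace A) + Re (op_trace B)"
      using jordan_decomposition[OF X(2,1)] by blast
    have "\<Phi> A = (\<lambda>v. \<Phi> X v + \<Phi> B v)"
      unfolding X_eq using X(1) B(2) by (rule add)
    moreover have "positive_op (\<Phi> A)" "positive_op (\<Phi> B)"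
      using pos A B by (simp_all add: positive_map_def)
    ultimately have "trace_norm (\<Phi> X) \<le> Re (op_trace (\<Phi> A)) + Re (op_trace (\<Phi> B))"
      by (intro trace_norm_le_if_diff_positive[OF herm[OF X] tc[OF X(1)] _ tc[OF A(2)] _ tc[OF B(2)]])
    then show "trace_norm (\<Phi> X) \<le> trace_norm X"
      by (simp add: norm trace A(2) B(2))
  next
    assume contr: "\<forall>X\<in>trace_class. hermitian X \<longrightarrow> trace_norm (\<Phi> X) \<le> trace_norm X"
    show "positive_map \<Phi>"
      unfolding positive_map_def
    proof (intro ballI impI)
      fix X :: "'h \<Rightarrow> 'h" assume X: "X \<in> trace_class" "positive_op X"
      then have "trace_norm (\<Phi> X) \<le> Re (op_trace (\<Phi> X))"
        using contr by (simp add: trace positive_op_hermitian flip: trace_norm_positive)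
      then show "positive_op (\<Phi> X)"
        using positive_if_trace_norm_le_trace[OF herm tc] X positive_op_hermitian by blast
    qed
  qed
qed

end
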